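(* Let $s\ge 1$ be an integer, $r>1$ real, $t\ge 1$, and let $\mathcal{D}_1,\dots,\mathcal{D}_t$ be nonempty data segments with values in a finite universe $U$. Put $\alpha = 2\,\frac{s}{\max_{1\le i\le t}|\mathcal{D}_i|}\,\frac{r-1}{r^2}$. If the summaries $S_1,\dots,S_t$ are constructed successively by the procedure CoopFreq with size $s$ and parameter $r$, then $$\max_{x\in U}|\varepsilon_t(x)|\le \frac1\alpha\ln\Big(1+\alpha r\sum_{i=1}^{t}|\mathcal{D}_i|\Big).$$
   Context: A data segment $\mathcal{D}$ is a finite multiset of values; $f_{\mathcal{D}}(x)\in\mathbb{Z}_{\ge 0}$ is the number of occurrences of $x$ in $\mathcal{D}$ and $|\mathcal{D}|=\sum_x f_{\mathcal{D}}(x)$. A summary $S$ of size $s$ is a finite map $x\mapsto\gamma_x$ from at most $s$ values to real counts; its frequency estimate is $f_S(x)=\gamma_x$ if $x$ is stored in $S$ and $f_S(x)=0$ otherwise. $U$ is a fixed finite set containing all values occurring in the segments. For a sequence of segments $\mathcal{D}_1,\mathcal{D}_2,\dots$ with summaries $S_1,S_2,\dots$, the cumulative (prefix) frequency error is $\varepsilon_t(x)=\sum_{i=1}^t\big(f_{\mathcal{D}_i}(x)-f_{S_i}(x)\big)$, with $\varepsilon_0\equiv 0$. Procedure CoopFreq (size $s$, parameter $r$), producing $S_t$ from $\mathcal{D}_t$ and $\varepsilon_{t-1}$: let $h=|\mathcal{D}_t|/s$ and $e(x)=\varepsilon_{t-1}(x)+f_{\mathcal{D}_t}(x)$. First store in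 $S_t$ every $x$ with $f_{\mathcal{D}_t}(x)\ge h$, with its exact count $f_{\mathcal{D}_t}(x)$. Then, while $S_t$ stores fewer than $s$ values (and some value occurring in $\mathcal{D}_1,\dots,\mathcal{D}_t$ is not yet stored in $S_t$), choose a value $x_m$ maximizing $e(x)$ among the values occurring in $\mathcal{D}_1,\dots,\mathcal{D}_t$ not yet stored in $S_t$ (ties broken arbitrarily), and store $x_m\mapsto\min(r h,\,e(x_m))$. *)

theory Defs
  imports Complex_Main "HOL-Library.Multiset"
begin

type_synonym 'a summary = "'a \<rightharpoonup> real"

definition summary_of_size :: "nat \<Rightarrow> 'a summary \<Rightarrow> bool" where
  "summary_of_size s S \<longleftrightarrow> finite (dom S) \<and> card (dom S) \<le> s"

definition est :: "'a summary \<Rightarrow> 'a \<Rightarrow> real" where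
  "est S x = (case S x of Some \<gamma> \<Rightarrow> \<gamma> | None \<Rightarrow> 0)"

(* Segments and summaries are numbered from 1; the entry at index 0 is never used. *)

definition prefix_error :: "(nat \<Rightarrow> 'a multiset) \<Rightarrow> (nat \<Rightarrow> 'a summary) \<Rightarrow> nat \<Rightarrow> 'a \<Rightarrow> real" where
  "prefix_error D S t x = (\<Sum>i = 1..t. real (count (D i) x) - est (S i) x)"

definition occurring :: "(nat \<Rightarrow> 'a multiset) \<Rightarrow> nat \<Rightarrow> 'a set" where
  "occurring D t = (\<Union>i\<in>{1..t}. set_mset (D i))"

definition heavy_summary :: "'a multiset \<Rightarrow> real \<Rightarrow> 'a summary" where
  "heavy_summary M h = (\<lambda>x. if real (count M x) \<ge> h then Some (real (count M x)) else None)"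

(* fill_loop s r h V e S S': the while loop, started with summary S, can terminate with S'.
   Here V is the set of candidate values and e the cumulative count being maximised.
   It is a relation rather than a function because ties are broken arbitrarily. *)

inductive fill_loop ::
    "nat \<Rightarrow> real \<Rightarrow> real \<Rightarrow> 'a set \<Rightarrow> ('a \<Rightarrow> real) \<Rightarrow> 'a summary \<Rightarrow> 'a summary \<Rightarrow> bool"
  for s r h V e where
    stop: "\<not> (card (dom S) < s \<and> V - dom S \<noteq> {}) \<Longrightarrow> fill_loop s r h V e S S"
  | store: "\<lbrakk>card (dom S) < s; xm \<in> V - dom S; \<forall>y\<in>V - dom S. e y \<le> e xm;
      fill_loop s r h V e (S(xm \<mapsto> min (r * h) (e xm))) S'\<rbrakk>
      \<Longrightarrow> fill_loop s r h V e S S'"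

definition coop_freq_step ::
    "nat \<Rightarrow> real \<Rightarrow> 'a set \<Rightarrow> 'a multiset \<Rightarrow> ('a \<Rightarrow> real) \<Rightarrow> 'a summary \<Rightarrow> bool" where
  "coop_freq_step s r V M err S \<longleftrightarrow>
     (let h = real (size M) / real s
      in fill_loop s r h V (\<lambda>x. err x + real (count M x)) (heavy_summary M h) S)"

definition coop_freq ::
    "nat \<Rightarrow> real \<Rightarrow> (nat \<Rightarrow> 'a multiset) \<Rightarrow> nat \<Rightarrow> (nat \<Rightarrow> 'a summary) \<Rightarrow> bool" where
  "coop_freq s r D t S \<longleftrightarrow>
     (\<forall>i\<in>{1..t}. coop_freq_step s r (occurring D i) (D i) (prefix_error D S (i - 1)) (S i))"

(* The procedure does produce summaries of size s, and it never gets stuck. *)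

lemma heavy_summary_size:
  assumes "s \<ge> 1" "M \<noteq> {#}"
  shows "summary_of_size s (heavy_summary M (real (size M) / real s))"
proof -
  let ?h = "real (size M) / real s"
  let ?H = "dom (heavy_summary M ?h)"
  have h: "?h > 0" using assms by (simp add: nonempty_has_size)
  have H: "?H = {x. real (count M x) \<ge> ?h}"
    by (auto simp: heavy_summary_def dom_def)
  have sub: "?H \<subseteq> set_mset M"
  proof
    fix x assume "x \<in> ?H"
    then have "real (count M x) \<ge> ?h" using H by blast
    then have "0 < real (count M x)" using h by linarith
    then have "0 < count M x" by linarith
    then show "x \<in># M" by (rule count_greater_zero_iff[THEN iffD1])
  qed
  then have fin: "finite ?H" by (rule finite_subset) simp
  have "real (card ?H) * ?h = (\<Sum>x\<in>?H. ?h)" by simp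
  also have "\<dots> \<le> (\<Sum>x\<in>?H. real (count M x))" by (rule sum_mono) (use H in auto)
  also have "\<dots> \<le> (\<Sum>x\<in>set_mset M. real (count M x))" using sub by (intro sum_mono2) auto
  also have "\<dots> = real s * ?h" using assms by (simp add: size_multiset_overloaded_eq)
  finally have "real (card ?H) \<le> real s" using h by (rule mult_right_le_imp_le)
  then have "card ?H \<le> s" by simp
  with fin show ?thesis by (simp add: summary_of_size_def)
qed

lemma fill_loop_size:
  "fill_loop s r h V e S S' \<Longrightarrow> summary_of_size s S \<Longrightarrow> summary_of_size s S'"
  by (induction rule: fill_loop.induct) (auto simp: summary_of_size_def)

lemma coop_freq_step_size:
  assumes "coop_freq_step s r V M err S" "s \<ge> 1" "M \<noteq> {#}"
  shows "summary_of_size s S"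
  using assms fill_loop_size heavy_summary_size unfolding coop_freq_step_def Let_def by blast

lemma fill_loop_exists:
  assumes "finite V"
  shows "\<exists>S'. fill_loop s r h V e S S'"
proof (induction "card (V - dom S)" arbitrary: S rule: less_induct)
  case less
  show ?case
  proof (cases "card (dom S) < s \<and> V - dom S \<noteq> {}")
    case False
    then show ?thesis using fill_loop.stop by blast
  next
    case True
    have fin: "finite (V - dom S)" using assms by simp
    have "Max (e ` (V - dom S)) \<in> e ` (V - dom S)" using True fin by (intro Max_in) auto
    then obtain x where x: "x \<in> V - dom S" "e x = Max (e ` (V - dom S))"
      by (elim imageE) simp
    then have mx: "\<forall>y\<in>V - dom S. e y \<le> e x" using fin by simp
    let ?S = "S(x \<mapsto> min (r * h) (e x))"
    have "card (V - dom ?S) < card (V - dom S)"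
      using x fin by (intro psubset_card_mono) auto
    then obtain S' where "fill_loop s r h V e ?S S'" using less by blast
    then show ?thesis using fill_loop.store True x(1) mx by metis
  qed
qed

lemma coop_freq_step_exists:
  "finite V \<Longrightarrow> \<exists>S. coop_freq_step s r V M err S"
  unfolding coop_freq_step_def Let_def by (rule fill_loop_exists)

end

(* With the potential \<Phi>(\<epsilon>) = (\<Sum>x. exp (\<alpha> \<epsilon>(x)) - 1), where \<epsilon> \<ge> 0 throughout, it suffices that
   processing a segment of size n raises \<Phi> by at most \<alpha> n.  Let h = n / s, let H be the set of
   heavy values, M the set of values stored by the loop and L a level separating the cumulative
   counts on M from those of the values left out.  Heavy values do not change \<Phi>; a light value with
   count \<delta> contributes at most exp (\<alpha> L) \<alpha> \<delta>, and if it is in M it gives back a further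
   exp (\<alpha> L) (1 - exp (- \<alpha> min(L, r h))).  The light counts sum to at most (s - |H|) h and
   |M| = s - |H|, so \<Phi> changes by at most
   exp (\<alpha> L) (s - |H|) (\<alpha> h - 1 + exp (- \<alpha> min(L, r h))).
   The choice of \<alpha> gives \<alpha> h \<le> 1 - exp (- \<alpha> r h), which makes this \<le> 0 for L \<ge> r h and
   at most (s - |H|) \<alpha> h for L < r h. *)

theory Submission
  imports Defs
begin

section \<open>An exponential inequality and the filling loop\<close>

text \<open>The product of 1 - y + y^2/2 and 1 + y + y^2/2 is 1 + y^4/4, and \<open>exp y\<close>
  dominates the second factor; dividing by \<open>exp y\<close> gives the bound.\<close>

lemma exp_minus_le_quadratic:
  fixes y :: real
  assumes "0 \<le> y"
  shows "exp (- y) \<le> 1 - y + y\<^sup>2 / 2"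
proof -
  have "1 \<le> 1 + (y\<^sup>2)\<^sup>2 / 4"
    by simp
  also have "\<dots> = (1 - y + y\<^sup>2 / 2) * (1 + y + y\<^sup>2 / 2)"
    by (simp add: field_simps power2_eq_square)
  also have "\<dots> \<le> (1 - y + y\<^sup>2 / 2) * exp y"
  proof (rule mult_left_mono)
    show "1 + y + y\<^sup>2 / 2 \<le> exp y"
      using exp_lower_Taylor_quadratic[OF assms] by simp
    have "0 \<le> (1 - y)\<^sup>2 + 1" by simp
    then show "0 \<le> 1 - y + y\<^sup>2 / 2"
      by (simp add: power2_eq_square algebra_simps)
  qed
  finally show ?thesis
    by (simp add: exp_minus field_simps)
qed

text \<open>\<open>M\<close> collects the values chosen by the loop. A value that is maximal when
  chosen stays maximal against the values left at the end, because the set of remaining candidates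
  only shrinks.\<close>

lemma fill_loop_result:
  assumes "fill_loop s r h V e S S'"
  shows "\<exists>M. M \<subseteq> V - dom S \<and> dom S' = dom S \<union> M \<and> (\<forall>x\<in>dom S. S' x = S x)
    \<and> (\<forall>x\<in>M. S' x = Some (min (r * h) (e x)))
    \<and> (\<forall>x\<in>M. \<forall>y\<in>V - dom S'. e y \<le> e x) \<and> (card (dom S') \<ge> s \<or> V \<subseteq> dom S')"
  using assms
proof (induction rule: fill_loop.induct)
  case (stop S)
  then show ?case by (intro exI[of _ "{}"]) auto
next
  case (store S xm S')
  let ?T = "S(xm \<mapsto> min (r * h) (e xm))"
  obtain M where M: "M \<subseteq> V - dom ?T" "dom S' = dom ?T \<union> M" "\<forall>x\<in>dom ?T. S' x = ?T x"
    "\<forall>x\<in>M. S' x = Some (min (r * h) (e x))" "\<forall>x\<in>M. \<forall>y\<in>V - dom S'. e y \<le> e x"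
    "card (dom S') \<ge> s \<or> V \<subseteq> dom S'"
    using store.IH by blast
  have "\<forall>x\<in>dom S. S' x = S x"
    using M(3) store.hyps(2) by auto
  moreover have "S' xm = Some (min (r * h) (e xm))"
    using M(3) by simp
  ultimately show ?case
    using M store.hyps(2,3) by (intro exI[of _ "insert xm M"]) auto
qed

lemma separating_level:
  fixes e :: "'a \<Rightarrow> real"
  assumes "finite V" "M \<subseteq> V" "\<forall>x\<in>V. 0 \<le> e x" "\<forall>x\<in>M. \<forall>y\<in>R. e y \<le> e x" "R \<subseteq> V"
  obtains L where "0 \<le> L" "\<forall>x\<in>M. L \<le> e x" "\<forall>y\<in>R. e y \<le> L"
proof (cases "M = {}")
  case True
  \<comment> \<open>With \<open>M\<close> empty, \<open>L\<close> only has to be nonnegative and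
    bound \<open>e\<close> on \<open>R\<close>; inserting 0 secures the sign and covers empty
    \<open>V\<close>.\<close>
  have "0 \<le> Max (insert 0 (e ` V))" "\<forall>y\<in>R. e y \<le> Max (insert 0 (e ` V))"
    using assms by (auto intro!: Max_ge)
  with True that show ?thesis by blast
next
  case False
  have fin: "finite M" using assms finite_subset by blast
  then have "Min (e ` M) \<in> e ` M" using False by (intro Min_in) auto
  then obtain x where "x \<in> M" "Min (e ` M) = e x" by blast
  moreover have "\<forall>x\<in>M. Min (e ` M) \<le> e x" using fin by simp
  ultimately show ?thesis using that[of "e x"] assms by auto
qed

lemma est_Some: "S x = Some c \<Longrightarrow> est S x = c"
  and est_None: "x \<notin> dom S \<Longrightarrow> est S x = 0"
  by (auto simp: est_def domIff)

section \<open>Change of the potential in one step\<close>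

text \<open>The constant -1 of each term of the potential is dropped, since it cancels in
  differences. Nonnegativity of the error is proved alongside because the next step assumes
  it.\<close>

lemma coop_freq_step_potential:
  fixes err err' :: "'a \<Rightarrow> real"
  assumes s: "s \<ge> 1" and r: "r > 1" and U: "finite U" "V \<subseteq> U" "set_mset N \<subseteq> V"
    and N: "N \<noteq> {#}"
    and \<alpha>: "\<alpha> > 0" "\<alpha> * (real (size N) / real s) * r\<^sup>2 \<le> 2 * (r - 1)"
    and err: "\<And>x. 0 \<le> err x"
    and step: "coop_freq_step s r V N err S"
    and err': "\<And>x. err' x = err x + real (count N x) - est S x"
  shows "\<And>x. 0 \<le> err' x"
    and "(\<Sum>x\<in>U. exp (\<alpha> * err' x)) \<le> (\<Sum>x\<in>U. exp (\<alpha> * err x)) + \<alpha> * real (size N)"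
proof -
  define h where "h = real (size N) / real s"
  define \<delta> where "\<delta> x = real (count N x)" for x
  define e where "e x = err x + \<delta> x" for x
  define S0 where "S0 = heavy_summary N h"
  define H where "H = dom S0"
  have h: "h > 0" and n: "real (size N) = real s * h"
    using s N by (simp_all add: h_def nonempty_has_size)
  have rh: "h < r * h" using h r by simp
  have H_iff: "x \<in> H \<longleftrightarrow> h \<le> \<delta> x" for x
    by (auto simp: H_def S0_def heavy_summary_def \<delta>_def dom_def)
  have \<delta>0: "0 \<le> \<delta> x" for x by (simp add: \<delta>_def)
  have e0: "0 \<le> e x" for x using err \<delta>0 by (simp add: e_def)
  have HV: "H \<subseteq> V"
  proof
    fix x assume "x \<in> H"
    then have "0 < \<delta> x" using H_iff h by force
    then have "x \<in># N" by (simp add: \<delta>_def)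
    then show "x \<in> V" using U by blast
  qed
  have finV: "finite V" using U(2,1) by (rule finite_subset)
  with HV have finH: "finite H" by (rule finite_subset)
  have Hs: "card H \<le> s"
    using heavy_summary_size[OF s N] by (simp add: summary_of_size_def H_def S0_def h_def)
  have "fill_loop s r h V e S0 S"
    using step unfolding coop_freq_step_def Let_def h_def S0_def e_def \<delta>_def .
  from fill_loop_result[OF this] obtain M where
    MV: "M \<subseteq> V - H" and domS: "dom S = H \<union> M" and SH: "\<forall>x\<in>H. S x = S0 x"
    and SM: "\<forall>x\<in>M. S x = Some (min (r * h) (e x))"
    and Mmax: "\<forall>x\<in>M. \<forall>y\<in>V - dom S. e y \<le> e x"
    and full: "card (dom S) \<ge> s \<or> V \<subseteq> dom S"
    unfolding H_def by blast
  have finM: "finite M" using MV finV by (auto intro: finite_subset)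
  have errH: "err' x = err x" if "x \<in> H" for x
  proof -
    have "S x = Some (\<delta> x)"
      using SH that H_iff[of x] by (simp add: S0_def heavy_summary_def \<delta>_def)
    then show ?thesis by (simp add: err' est_Some \<delta>_def)
  qed
  have errM: "err' x = max (e x - r * h) 0" if "x \<in> M" for x
    using SM that by (auto simp: err' est_Some e_def \<delta>_def)
  have errR: "err' x = e x" if "x \<notin> H" "x \<notin> M" for x
    using that domS by (simp add: err' est_None e_def \<delta>_def)
  have light: "\<delta> x \<le> h" if "x \<notin> H" for x using that H_iff[of x] by simp
  show "0 \<le> err' x" for x
    using errH errM errR err e0 by (cases "x \<in> H"; cases "x \<in> M") (auto simp: max_def)
  show "(\<Sum>x\<in>U. exp (\<alpha> * err' x)) \<le> (\<Sum>x\<in>U. exp (\<alpha> * err x)) + \<alpha> * real (size N)"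
  \<comment> \<open>If every candidate is stored, no error grows. Otherwise the loop ended because
    all \<open>s\<close> places are taken, which provides at least \<open>s - card H\<close> values
    in \<open>M\<close>.\<close>
  proof (cases "V \<subseteq> dom S")
    case True
    have "err' x \<le> err x" for x
    proof -
      consider "x \<in> H" | "x \<in> M" | "x \<notin> H" "x \<notin> M" by blast
      then show ?thesis
      proof cases
        case 1
        then show ?thesis using errH by simp
      next
        case 2
        \<comment> \<open>A light value gains at most \<open>h < r * h\<close>, so subtracting up to
          \<open>r * h\<close> undoes the gain.\<close>
        then have "x \<notin> H" using MV by blast
        then show ?thesis using errM[OF 2] light[of x] rh err[of x] by (simp add: e_def)
      next
        case 3
        then have "x \<notin># N" using True domS U(3) by blast
        then have "\<delta> x = 0" by (simp add: \<delta>_def not_in_iff)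
        then show ?thesis using errR 3 by (simp add: e_def)
      qed
    qed
    then have "(\<Sum>x\<in>U. exp (\<alpha> * err' x)) \<le> (\<Sum>x\<in>U. exp (\<alpha> * err x))"
      using \<alpha> by (intro sum_mono) simp
    moreover have "0 \<le> \<alpha> * real (size N)" using \<alpha> by simp
    ultimately show ?thesis by linarith
  next
    case False
    then have "s \<le> card (H \<union> M)" using full domS by simp
    also have "\<dots> = card H + card M"
      using finH finM MV by (intro card_Un_disjoint) auto
    finally have cardM: "real s - real (card H) \<le> real (card M)" by linarith
    obtain L where L: "0 \<le> L" "\<forall>x\<in>M. L \<le> e x" "\<forall>y\<in>V - dom S. e y \<le> L"
      using separating_level[OF finV, of M e "V - dom S"] MV Mmax e0 by blast
    \<comment> \<open>\<open>g\<close> is the decrease credited to each stored value: the drop of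
      \<open>exp (\<alpha> * L)\<close> when the level \<open>L\<close> is lowered by
      \<open>m\<close>.\<close>
    define m where "m = min L (r * h)"
    define E where "E = exp (\<alpha> * L)"
    define g where "g = E * (1 - exp (- (\<alpha> * m)))"
    have m: "0 \<le> m" using L h r by (simp add: m_def)
    then have g: "0 \<le> g" using \<alpha> by (simp add: g_def E_def)
    have E: "0 < E" by (simp add: E_def)
    have E\<delta>: "E * (1 - exp (- (\<alpha> * \<delta> x))) \<le> E * \<alpha> * \<delta> x" for x
      using exp_ge_add_one_self[of "- (\<alpha> * \<delta> x)"] E by (simp add: mult.assoc)
    have err_e: "exp (\<alpha> * err x) = exp (\<alpha> * e x) * exp (- (\<alpha> * \<delta> x))" for x
      by (simp add: e_def exp_add[symmetric] algebra_simps)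
    have change: "exp (\<alpha> * err' x) - exp (\<alpha> * err x)
        \<le> (if x \<in> H then 0 else E * \<alpha> * \<delta> x) - (if x \<in> M then g else 0)" for x
    proof -
      consider "x \<in> H" "x \<notin> M" | "x \<notin> H" "x \<in> M" | "x \<notin> H" "x \<notin> M" "x \<in> V"
        | "x \<notin> H" "x \<notin> M" "x \<notin> V"
        using MV by blast
      then show ?thesis
      proof cases
        case 1
        then show ?thesis using errH by simp
      next
        case 2
        have \<delta>rh: "\<delta> x \<le> r * h" using light[OF 2(1)] rh by simp
        have Le: "L \<le> e x" using L 2 by blast
        have "exp (\<alpha> * err' x) - exp (\<alpha> * err x) \<le> E * (exp (- (\<alpha> * m)) - exp (- (\<alpha> * \<delta> x)))"
        proof (cases "L \<ge> r * h")
          case True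
          have "exp (\<alpha> * err' x) - exp (\<alpha> * err x)
              = exp (\<alpha> * e x) * (exp (- (\<alpha> * (r * h))) - exp (- (\<alpha> * \<delta> x)))"
            using errM[OF 2(2)] True Le
            by (simp add: err_e exp_add[symmetric] algebra_simps max_def)
          \<comment> \<open>The bracket is nonpositive since \<open>\<delta> x \<le> r * h\<close>,
            so replacing \<open>e x\<close> by the smaller \<open>L\<close> increases the
            product.\<close>
          also have "\<dots> \<le> E * (exp (- (\<alpha> * (r * h))) - exp (- (\<alpha> * \<delta> x)))"
            using \<delta>rh Le \<alpha> unfolding E_def by (intro mult_right_mono_neg) auto
          finally show ?thesis using True by (simp add: m_def min_def)
        next
          case False
          \<comment> \<open>Here \<open>m = L\<close>, and the right-hand side is the target
            multiplied out. If \<open>e x\<close> reaches \<open>r * h\<close>, it is first lowered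
            to \<open>r * h\<close>; otherwise the new error is 0 and \<open>err x\<close> is at
            least \<open>L - \<delta> x\<close>.\<close>
          have "exp (\<alpha> * err' x) - exp (\<alpha> * err x) \<le> 1 - exp (\<alpha> * (L - \<delta> x))"
          proof (cases "e x \<ge> r * h")
            case True
            have "exp (\<alpha> * err' x) - exp (\<alpha> * err x)
                = exp (\<alpha> * e x) * (exp (- (\<alpha> * (r * h))) - exp (- (\<alpha> * \<delta> x)))"
              using errM[OF 2(2)] True
              by (simp add: err_e exp_add[symmetric] algebra_simps max_def)
            also have "\<dots> \<le> exp (\<alpha> * (r * h)) * (exp (- (\<alpha> * (r * h))) - exp (- (\<alpha> * \<delta> x)))"
              using \<delta>rh True \<alpha> by (intro mult_right_mono_neg) auto
            also have "\<dots> = 1 - exp (\<alpha> * (r * h - \<delta> x))"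
              by (simp add: exp_add[symmetric] algebra_simps)
            also have "\<dots> \<le> 1 - exp (\<alpha> * (L - \<delta> x))"
              using False \<alpha> by simp
            finally show ?thesis .
          next
            case small: False
            then have "err' x = 0" using errM[OF 2(2)] by simp
            moreover have "\<alpha> * (L - \<delta> x) \<le> \<alpha> * err x" using Le \<alpha> by (simp add: e_def)
            ultimately show ?thesis by simp
          qed
          then show ?thesis using False
            by (simp add: m_def min_def E_def exp_add[symmetric] algebra_simps)
        qed
        also have "\<dots> = E * (1 - exp (- (\<alpha> * \<delta> x))) - g"
          by (simp add: g_def algebra_simps)
        finally show ?thesis using 2 E\<delta>[of x] by simp
      next
        case 3
        then have "e x \<le> L" using L domS by blast
        then have "exp (\<alpha> * e x) * (1 - exp (- (\<alpha> * \<delta> x))) \<le> E * (1 - exp (- (\<alpha> * \<delta> x)))"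
          using \<alpha> \<delta>0 unfolding E_def by (intro mult_right_mono) auto
        moreover have "exp (\<alpha> * err' x) - exp (\<alpha> * err x)
            = exp (\<alpha> * e x) * (1 - exp (- (\<alpha> * \<delta> x)))"
          using errR 3 by (simp add: err_e algebra_simps)
        ultimately show ?thesis using 3 E\<delta>[of x] by simp
      next
        case 4
        then have "x \<notin># N" using U(3) by blast
        then have "\<delta> x = 0" by (simp add: \<delta>_def not_in_iff)
        then show ?thesis using errR 4 by (simp add: e_def)
      qed
    qed
    \<comment> \<open>Of the total mass \<open>s * h\<close>, each heavy value takes at least
      \<open>h\<close>; the rest bounds the light counts.\<close>
    have "real (card H) * h \<le> (\<Sum>x\<in>H. \<delta> x)"
      using sum_mono[of H "\<lambda>_. h" \<delta>] H_iff by simp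
    moreover have "(\<Sum>x\<in>U. \<delta> x) = real s * h"
    proof -
      have "(\<Sum>x\<in>U. \<delta> x) = (\<Sum>x\<in>set_mset N. \<delta> x)"
        using U by (intro sum.mono_neutral_right) (auto simp: \<delta>_def not_in_iff)
      then show ?thesis by (simp add: \<delta>_def n[symmetric] size_multiset_overloaded_eq)
    qed
    moreover have "(\<Sum>x\<in>U. \<delta> x) = (\<Sum>x\<in>U - H. \<delta> x) + (\<Sum>x\<in>H. \<delta> x)"
      using U HV by (intro sum.subset_diff) auto
    ultimately have lightsum: "(\<Sum>x\<in>U - H. \<delta> x) \<le> (real s - real (card H)) * h"
      by (simp add: algebra_simps)
    have "(\<Sum>x\<in>U. exp (\<alpha> * err' x)) - (\<Sum>x\<in>U. exp (\<alpha> * err x))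
        \<le> (\<Sum>x\<in>U. (if x \<in> H then 0 else E * \<alpha> * \<delta> x) - (if x \<in> M then g else 0))"
      unfolding sum_subtractf[symmetric] by (intro sum_mono change)
    also have "\<dots> = (\<Sum>x\<in>U - H. E * \<alpha> * \<delta> x) - (\<Sum>x\<in>M. g)"
    proof -
      have "(\<Sum>x\<in>U. if x \<in> H then 0 else E * \<alpha> * \<delta> x) = (\<Sum>x\<in>U - H. E * \<alpha> * \<delta> x)"
        using U by (intro sum.mono_neutral_cong_right) auto
      moreover have "(\<Sum>x\<in>U. if x \<in> M then g else 0) = (\<Sum>x\<in>M. g)"
        using U MV by (intro sum.mono_neutral_cong_right) auto
      ultimately show ?thesis by (simp add: sum_subtractf)
    qed
    also have "\<dots> = E * \<alpha> * (\<Sum>x\<in>U - H. \<delta> x) - real (card M) * g"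
      by (simp add: sum_distrib_left)
    also have "\<dots> \<le> E * \<alpha> * ((real s - real (card H)) * h) - (real s - real (card H)) * g"
      using lightsum cardM E \<alpha> g by (intro diff_mono mult_left_mono mult_right_mono) auto
    also have "\<dots> = (real s - real (card H)) * (E * (\<alpha> * h - 1 + exp (- (\<alpha> * m))))"
      by (simp add: g_def algebra_simps)
    also have "\<dots> \<le> (real s - real (card H)) * (\<alpha> * h)"
    proof (rule mult_left_mono)
      \<comment> \<open>For this \<open>y\<close>, the assumption on \<open>\<alpha>\<close>
        multiplied by \<open>\<alpha> * h\<close> says exactly that y^2/2 is at most
        \<open>y - \<alpha> * h\<close>; the quadratic bound on \<open>exp (- y)\<close> then gives
        \<open>key\<close>.\<close>
      define y where "y = \<alpha> * (r * h)"
      have "0 \<le> y" using \<alpha> r h by (simp add: y_def)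
      then have "exp (- y) \<le> 1 - y + y\<^sup>2 / 2" by (rule exp_minus_le_quadratic)
      moreover have "y\<^sup>2 / 2 \<le> y - \<alpha> * h"
      proof -
        have "y\<^sup>2 = (\<alpha> * h) * (\<alpha> * h * r\<^sup>2)"
          by (simp add: y_def power2_eq_square)
        also have "\<dots> \<le> (\<alpha> * h) * (2 * (r - 1))"
          using \<alpha> h by (intro mult_left_mono) (auto simp: h_def)
        finally show ?thesis by (simp add: y_def algebra_simps)
      qed
      ultimately have key: "\<alpha> * h \<le> 1 - exp (- y)" by argo
      show "E * (\<alpha> * h - 1 + exp (- (\<alpha> * m))) \<le> \<alpha> * h"
      proof (cases "L \<ge> r * h")
        case True
        then have "\<alpha> * h - 1 + exp (- (\<alpha> * m)) \<le> 0"
          using key by (simp add: m_def y_def min_def)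
        then have "E * (\<alpha> * h - 1 + exp (- (\<alpha> * m))) \<le> 0"
          using E by (intro mult_nonneg_nonpos) auto
        moreover have "0 \<le> \<alpha> * h" using \<alpha> h by simp
        ultimately show ?thesis by linarith
      next
        case False
        \<comment> \<open>As \<open>E * exp (- (\<alpha> * L)) = 1\<close>, the left-hand side
          equals \<open>1 - E * (1 - \<alpha> * h)\<close>, which is largest at
          \<open>E = 1\<close>.\<close>
        have "\<alpha> * h \<le> 1" using key exp_gt_zero[of "- y"] by linarith
        moreover have "1 \<le> E" using \<alpha> L by (simp add: E_def)
        ultimately have "1 * (1 - \<alpha> * h) \<le> E * (1 - \<alpha> * h)"
          by (intro mult_right_mono) auto
        moreover have "E * exp (- (\<alpha> * m)) = 1"
          using False by (simp add: E_def m_def min_def exp_add[symmetric])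
        ultimately show ?thesis by (simp add: algebra_simps)
      qed
    qed (use Hs in simp)
    also have "\<dots> \<le> real s * (\<alpha> * h)"
      using \<alpha> h by (intro mult_right_mono) auto
    finally show ?thesis by (simp add: n algebra_simps)
  qed
qed

section \<open>Accumulation over all segments\<close>

text \<open>Induction on the number of processed segments: the zero error contributes 1 for each
  element of \<open>U\<close>, and the segment \<open>D i\<close> adds at most \<alpha> times its
  size.\<close>

lemma coop_freq_potential:
  assumes s: "s \<ge> 1" and r: "r > 1" and U: "finite U"
    and D: "\<forall>i\<in>{1..t}. D i \<noteq> {#} \<and> set_mset (D i) \<subseteq> U"
    and \<alpha>: "\<alpha> > 0" "\<forall>i\<in>{1..t}. \<alpha> * (real (size (D i)) / real s) * r\<^sup>2 \<le> 2 * (r - 1)"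
    and step: "coop_freq s r D t S"
    and k: "k \<le> t"
  shows "(\<forall>x. 0 \<le> prefix_error D S k x)
    \<and> (\<Sum>x\<in>U. exp (\<alpha> * prefix_error D S k x))
      \<le> real (card U) + \<alpha> * (\<Sum>i = 1..k. real (size (D i)))"
  using k
proof (induction k)
  case 0
  then show ?case by (simp add: prefix_error_def)
next
  case (Suc k)
  then have k: "Suc k \<in> {1..t}" by simp
  have V: "occurring D (Suc k) \<subseteq> U" "set_mset (D (Suc k)) \<subseteq> occurring D (Suc k)"
    using D Suc.prems by (force simp: occurring_def)+
  have err: "\<And>x. 0 \<le> prefix_error D S k x" using Suc by simp
  have cs: "coop_freq_step s r (occurring D (Suc k)) (D (Suc k)) (prefix_error D S k) (S (Suc k))"
    using step k unfolding coop_freq_def by fastforce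
  have rec: "\<And>x. prefix_error D S (Suc k) x
      = prefix_error D S k x + real (count (D (Suc k)) x) - est (S (Suc k)) x"
    by (simp add: prefix_error_def)
  have "D (Suc k) \<noteq> {#}" using D k by blast
  note pot = coop_freq_step_potential[OF s r U V this \<alpha>(1) bspec[OF \<alpha>(2) k] err cs rec]
  show ?case
    using pot Suc.IH Suc.prems by (auto simp: algebra_simps)
qed

theorem theorem1:
  fixes s t :: nat and r \<alpha> :: real and U :: "'a set"
    and D :: "nat \<Rightarrow> 'a multiset" and S :: "nat \<Rightarrow> 'a summary"
  assumes "s \<ge> 1" and "r > 1" and "t \<ge> 1"
    and "finite U"
    and "\<forall>i\<in>{1..t}. D i \<noteq> {#} \<and> set_mset (D i) \<subseteq> U"
    and "\<alpha> = 2 * (real s / real (MAX i\<in>{1..t}. size (D i))) * ((r - 1) / r\<^sup>2)"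
    and "coop_freq s r D t S"
  shows "(MAX x\<in>U. \<bar>prefix_error D S t x\<bar>)
           \<le> 1 / \<alpha> * ln (1 + \<alpha> * r * (\<Sum>i = 1..t. real (size (D i))))"
proof -
  define n where "n = (MAX i\<in>{1..t}. size (D i))"
  define N where "N = (\<Sum>i = 1..t. real (size (D i)))"
  have size_le: "size (D i) \<le> n" if "i \<in> {1..t}" for i
    unfolding n_def using that by (intro Max_ge) auto
  have D1: "D 1 \<noteq> {#}" "set_mset (D 1) \<subseteq> U" using assms(3,5) by auto
  have "1 \<in> {1..t}" using assms(3) by simp
  from size_le[OF this] have n: "0 < n"
    using D1 by (simp add: nonempty_has_size)
  have \<alpha>_eq: "\<alpha> = 2 * (real s / real n) * ((r - 1) / r\<^sup>2)"
    using assms(6) by (simp add: n_def)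
  have \<alpha>: "\<alpha> > 0" using assms(1,2) n by (simp add: \<alpha>_eq)
  have \<alpha>n: "\<alpha> * (real n / real s) * r\<^sup>2 = 2 * (r - 1)"
    using assms(1,2) n by (simp add: \<alpha>_eq)
  \<comment> \<open>The given \<alpha> meets the one-step condition with equality for the largest
    segment, hence with \<le> for all.\<close>
  have bound: "\<alpha> * (real (size (D i)) / real s) * r\<^sup>2 \<le> 2 * (r - 1)" if "i \<in> {1..t}" for i
    unfolding \<alpha>n[symmetric] using size_le[OF that] \<alpha>
    by (intro mult_right_mono mult_left_mono divide_right_mono) auto
  have err: "\<And>x. 0 \<le> prefix_error D S t x"
    and pot: "(\<Sum>x\<in>U. exp (\<alpha> * prefix_error D S t x)) \<le> real (card U) + \<alpha> * N"
    using coop_freq_potential[OF assms(1,2,4,5) \<alpha> _ assms(7) order_refl] bound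
    unfolding N_def by auto
  have N: "0 \<le> N" by (simp add: N_def sum_nonneg)
  have "\<bar>prefix_error D S t x\<bar> \<le> 1 / \<alpha> * ln (1 + \<alpha> * r * N)" if x: "x \<in> U" for x
  proof -
    \<comment> \<open>All terms are nonnegative because the errors are, so the whole potential
      bounds each single one.\<close>
    have "exp (\<alpha> * prefix_error D S t x) - 1 \<le> (\<Sum>y\<in>U. exp (\<alpha> * prefix_error D S t y) - 1)"
      using x assms(4) \<alpha> err by (intro member_le_sum) auto
    also have "\<dots> \<le> \<alpha> * N" using pot by (simp add: sum_subtractf)
    also have "\<dots> \<le> \<alpha> * r * N"
      using \<alpha> N assms(2) by (intro mult_right_mono) auto
    finally have "exp (\<alpha> * prefix_error D S t x) \<le> 1 + \<alpha> * r * N" by simp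
    then have "\<alpha> * prefix_error D S t x \<le> ln (1 + \<alpha> * r * N)"
      using \<alpha> N assms(2) by (subst ln_ge_iff) (auto intro: add_pos_nonneg)
    then show ?thesis using \<alpha> err[of x] by (simp add: field_simps)
  qed
  moreover have "U \<noteq> {}" using D1 by auto
  ultimately show ?thesis
    using assms(4) unfolding N_def by (intro Max.boundedI) auto
qed

end
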